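(* For every graph $G$ with $n$ vertices, $$\operatorname{tw}(G)+\operatorname{tw}(\overline{G})\geq n-2,$$ where $\overline{G}$ denotes the complement of $G$ and $\operatorname{tw}$ denotes treewidth.
   Context: Graphs are finite, simple, undirected and nonempty. The complement $\overline{G}$ has the same vertex set as $G$, and two distinct vertices are adjacent in $\overline{G}$ if and only if they are not adjacent in $G$. Treewidth is the usual notion, defined via tree decompositions (minimum over tree decompositions of the maximum bag size minus one). Equivalently: for an integer $k\geq 0$, a graph $G$ is a $k$-tree if $G\cong K_{k+1}$ or $G-v$ is a $k$-tree for some vertex $v$ whose neighbours induce a $k$-clique (a clique on exactly $k$ vertices); $\operatorname{tw}(G)$ is the minimum integer $k$ such that $G$ is a spanning subgraph of a $k$-tree. *)

theory Defs
  imports "Graph_Theory.Digraph_Component"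
begin

text \<open>
  Finite simple undirected graphs are \<^locale>\<open>pair_graph\<close>s: an edge \<open>uv\<close> is represented by
  the two arcs \<open>(u, v)\<close> and \<open>(v, u)\<close>.
\<close>

definition graph_complement :: "'a pair_pre_digraph \<Rightarrow> 'a pair_pre_digraph" where
  "graph_complement G =
     \<lparr> pverts = pverts G,
       parcs = {(u, v). u \<in> pverts G \<and> v \<in> pverts G \<and> u \<noteq> v \<and> (u, v) \<notin> parcs G} \<rparr>"

text \<open>
  The library's \<^const>\<open>tree\<close> is not the undirected notion: \<^const>\<open>forest\<close> excludes directed
  cycles only. In a symmetric digraph every edge therefore counts as a cycle of length 2,
  whereas the acyclic orientation of a triangle counts as a tree. In a \<^locale>\<open>pair_graph\<close>,
  the cycles with at least three arcs are exactly the cycles of the undirected graph.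
\<close>

definition undirected_tree :: "'t pair_pre_digraph \<Rightarrow> bool" where
  "undirected_tree T \<longleftrightarrow>
     pair_graph T \<and> connected (with_proj T) \<and>
     \<not> (\<exists>p. pre_digraph.cycle (with_proj T) p \<and> length p \<ge> 3)"

text \<open>
  Since \<^const>\<open>connected\<close> includes being nonempty, the last condition below says that the nodes
  whose bags contain \<open>v\<close> form a nonempty subtree.
\<close>

definition tree_decomposition ::
    "'a pair_pre_digraph \<Rightarrow> 't pair_pre_digraph \<Rightarrow> ('t \<Rightarrow> 'a set) \<Rightarrow> bool" where
  "tree_decomposition G T B \<longleftrightarrow>
     undirected_tree T \<and>
     (\<Union>t \<in> pverts T. B t) = pverts G \<and>
     (\<forall>(u, v) \<in> parcs G. \<exists>t \<in> pverts T. u \<in> B t \<and> v \<in> B t) \<and>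
     (\<forall>v \<in> pverts G. connected (with_proj T \<restriction> {t \<in> pverts T. v \<in> B t}))"

text \<open>For nonempty graphs some bag is nonempty, so the subtraction does not truncate.\<close>

definition decomposition_width :: "'t pair_pre_digraph \<Rightarrow> ('t \<Rightarrow> 'a set) \<Rightarrow> nat" where
  "decomposition_width T B = Max ((\<lambda>t. card (B t)) ` pverts T) - 1"

text \<open>Decomposition trees are finite, so restricting their nodes to natural numbers loses nothing.\<close>

definition treewidth :: "'a pair_pre_digraph \<Rightarrow> nat" where
  "treewidth G =
     (LEAST k. \<exists>(T :: nat pair_pre_digraph) B.
        tree_decomposition G T B \<and> decomposition_width T B = k)"

end

theory Submission
  imports Defs
begin

text \<open>
  Take an optimal tree decomposition of \<open>G\<close> and one of its complement. Their widths add up to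
  at least \<open>n - 2\<close> because some bag of the first and some bag of the second together contain
  all vertices (\<open>tree_decompositions_bags_cover\<close>), and a bag has at most one element more than
  the width. Write \<open>S\<^sub>1 v\<close> and \<open>S\<^sub>2 v\<close> for the subtrees of nodes whose bags contain \<open>v\<close>.

  Call two vertices separated if \<open>S\<^sub>1 u\<close> and \<open>S\<^sub>1 v\<close> are disjoint. Separated vertices
  are distinct and not adjacent in \<open>G\<close>, so they are adjacent in the complement, and \<open>S\<^sub>2 u\<close> meets
  \<open>S\<^sub>2 v\<close>. Hence \<open>S\<^sub>2 u \<union> S\<^sub>2 v\<close> is a subtree for every separated pair. Any two such
  unions meet: given separated pairs \<open>u, v\<close> and \<open>x, y\<close>, the subtrees \<open>S\<^sub>1 u\<close> and \<open>S\<^sub>1 v\<close>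
  cannot both meet both of \<open>S\<^sub>1 x\<close> and \<open>S\<^sub>1 y\<close>, since this would close a cycle in the tree
  (\<open>crossing_subtrees_intersect\<close>; in graph terms, a chordal graph has no induced 4-cycle). So
  one of \<open>u, v\<close> is separated from one of \<open>x, y\<close>. In other words, the separated pairs form a
  bramble of the complement.

  By the Helly property of subtrees (\<open>subtrees_Helly\<close>) some node \<open>t\<^sub>2\<close> of the second tree
  lies in all these unions: its bag contains a vertex of every separated pair. The vertices
  outside this bag are therefore pairwise not separated, and the Helly property in the first
  tree puts all of them into one bag.
\<close>

section \<open>Connected sets of nodes\<close>

text \<open>
  Paths run inside \<open>S\<close>, but \<open>E\<close> is the arc relation of the whole graph. Unions of sets and
  deletions of nodes thus leave \<open>E\<close> unchanged, which induced subgraphs would not.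
\<close>

definition connected_in :: "'t rel \<Rightarrow> 't set \<Rightarrow> bool" where
  "connected_in E S \<longleftrightarrow> S \<noteq> {} \<and> (\<forall>u \<in> S. \<forall>v \<in> S. (u, v) \<in> rtrancl_on S E)"

lemma connected_in_Un:
  assumes "connected_in E A" "connected_in E B" "A \<inter> B \<noteq> {}"
  shows "connected_in E (A \<union> B)"
proof -
  obtain w where w: "w \<in> A" "w \<in> B"
    using assms(3) by blast
  have "(u, w) \<in> rtrancl_on (A \<union> B) E \<and> (w, u) \<in> rtrancl_on (A \<union> B) E" if "u \<in> A \<union> B" for u
    using that w assms(1,2)
      rtrancl_on_mono[of E E A "A \<union> B"] rtrancl_on_mono[of E E B "A \<union> B"]
    unfolding connected_in_def by blast
  then have "(u, v) \<in> rtrancl_on (A \<union> B) E" if "u \<in> A \<union> B" "v \<in> A \<union> B" for u v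
    using that rtrancl_on_trans[of u w "A \<union> B" E v] by simp
  then show ?thesis
    using w unfolding connected_in_def by blast
qed

lemma (in pair_graph) connected_in_if_connected:
  assumes "connected (with_proj G \<restriction> S)"
  shows "connected_in (parcs G) S"
proof -
  have "symcl (arcs_ends (with_proj G \<restriction> S)) \<subseteq> parcs G"
    by (auto simp: symcl_def arcs_ends_conv arcs_symmetric)
  then have "(u, v) \<in> rtrancl_on S (parcs G)"
    if "(u, v) \<in> rtrancl_on S (symcl (arcs_ends (with_proj G \<restriction> S)))" for u v
    using that by (rule rtrancl_on_mono[OF _ subset_refl])
  then show ?thesis
    using assms unfolding connected_conv connected_in_def induce_subgraph_verts by blast
qed

section \<open>The Helly property of subtrees\<close>

text \<open>
  The first vertex of a longest path inside \<open>U\<close> is a leaf: a neighbour off the path would extend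
  the path, and a neighbour on the path other than the second vertex would close a cycle. Paths
  without arcs are included, so an isolated vertex also counts as a leaf.
\<close>

lemma (in pair_graph) acyclic_obtain_leaf:
  assumes acyclic: "\<not> (\<exists>p. cycle p \<and> length p \<ge> 3)"
    and U: "U \<subseteq> pverts G" "U \<noteq> {}"
  obtains l where "l \<in> U"
    and "\<And>p q. \<lbrakk>p \<in> U; q \<in> U; (l, p) \<in> parcs G; (l, q) \<in> parcs G\<rbrakk> \<Longrightarrow> p = q"
proof -
  let ?P = "\<lambda>(u, p). (\<exists>v. apath u p v) \<and> set (pawalk_verts u p) \<subseteq> U"
  have finU: "finite U"
    using U(1) pair_finite_verts finite_subset by blast
  obtain u0 where "u0 \<in> U"
    using U(2) by blast
  then have ex: "?P (u0, [])"
    using U(1) by (auto simp: apath_def awalk_def)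
  have "length p < Suc (card U)" if "?P (u, p)" for u p
  proof -
    have "distinct (pawalk_verts u p)" "set (pawalk_verts u p) \<subseteq> U"
      using that by (auto simp: apath_def)
    then have "length (pawalk_verts u p) \<le> card U"
      using finU by (metis card_mono distinct_card)
    moreover have "length (pawalk_verts u p) = Suc (length p)"
      by (induct p arbitrary: u) auto
    ultimately show ?thesis by simp
  qed
  then have "\<exists>z. ?P z \<and> (\<forall>y. ?P y \<longrightarrow> length (snd y) \<le> length (snd z))"
    using ex by (intro ex_has_greatest_nat[of ?P _ "\<lambda>z. length (snd z)" "Suc (card U)"]) auto
  then obtain u p v where path: "apath u p v" "set (pawalk_verts u p) \<subseteq> U"
    and longest: "\<And>u' p' v'. \<lbrakk>apath u' p' v'; set (pawalk_verts u' p') \<subseteq> U\<rbrakk> \<Longrightarrow> length p' \<le> length p"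
    by (clarsimp simp: split_paired_all) (metis (no_types, lifting))
  have uU: "u \<in> U"
    using path by (cases p) (auto simp: apath_def awalk_Cons_iff)
  have neighbour: "q = snd (hd p)" if q: "q \<in> U" "(u, q) \<in> parcs G" for q
  proof -
    have qu: "(q, u) \<in> parcs G" "q \<noteq> u"
      using q arcs_symmetric no_loops' by auto
    have "q \<in> set (pawalk_verts u p)"
    proof (rule ccontr)
      assume "q \<notin> set (pawalk_verts u p)"
      then have "apath q ((q, u) # p) v"
        using path qu by (auto simp: apath_Cons_iff)
      then show False
        using longest[of q "(q, u) # p" v] path(2) q(1) by auto
    qed
    then obtain p1 p2 where p: "p = p1 @ p2" "awalk u p1 q" "awalk q p2 v"
      using path(1) awalk_decomp unfolding apath_def by blast
    have "apath u p1 q"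
      using path(1) p by (auto simp: apath_append_iff awalk_simps)
    \<comment> \<open>The arc back to \<open>u\<close> closes a cycle, which is too short to be excluded only if \<open>p1\<close> is a single arc.\<close>
    then have "cycle ((q, u) # p1)"
      using p qu by (auto simp: cycle_def apath_def awalk_Cons_iff)
    then have "length p1 < 2"
      using acyclic by (auto simp: not_le)
    moreover have "p1 \<noteq> []"
      using p(2) qu(2) by (auto simp: awalk_def)
    ultimately obtain e where "p1 = [e]"
      by (cases p1) auto
    then show ?thesis
      using p by (auto simp: awalk_Cons_iff awalk_def)
  qed
  show ?thesis
    by (rule that[OF uU]) (metis neighbour)
qed

text \<open>
  A path through \<open>l\<close> has to leave \<open>l\<close> by the arc along which it came, so the detour can be cut
  out. In the induction along a path from \<open>x\<close>, the case \<open>y = l\<close> therefore remembers a node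
  \<open>p\<close> before the detour, to which the path must return.
\<close>

lemma connected_in_delete_leaf:
  assumes conn: "connected_in E S" and ne: "S \<noteq> {l}" and "sym E"
    and leaf: "\<And>p q. \<lbrakk>p \<in> S; q \<in> S; (l, p) \<in> E; (l, q) \<in> E\<rbrakk> \<Longrightarrow> p = q"
  shows "connected_in E (S - {l})"
proof -
  let ?R = "rtrancl_on (S - {l}) E"
  have "if y = l then \<exists>p. (p, l) \<in> E \<and> (x, p) \<in> ?R else (x, y) \<in> ?R"
    if xy: "(x, y) \<in> rtrancl_on S E" and x: "x \<noteq> l" for x y
    using xy
  proof (induct rule: rtrancl_on_induct)
    case base
    then show ?case using x by auto
  next
    case (step y z)
    show ?case
    proof (cases "y = l")
      case False
      then show ?thesis
        using step by (auto intro: rtrancl_on_into_rtrancl_on)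
    next
      case True
      then obtain p where p: "(p, l) \<in> E" "(x, p) \<in> ?R"
        using step by auto
      show ?thesis
      proof (cases "z = l")
        case False
        have "p \<in> S" using p in_rtrancl_on_in_F by fastforce
        then have "z = p"
          using leaf[of z p] step True p \<open>sym E\<close> by (auto dest: symD)
        then show ?thesis using p False by simp
      qed (use p in auto)
    qed
  qed
  then have "(x, y) \<in> ?R" if "x \<in> S - {l}" "y \<in> S - {l}" for x y
    using that conn unfolding connected_in_def by (metis DiffD1 DiffD2 singletonI)
  moreover have "S - {l} \<noteq> {}"
    using conn ne unfolding connected_in_def by blast
  ultimately show ?thesis
    unfolding connected_in_def by blast
qed

lemma connected_in_obtain_neighbour:
  assumes "connected_in E S" "l \<in> S" "S \<noteq> {l}"
  obtains p where "p \<in> S" "(l, p) \<in> E" "p \<noteq> l"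
proof -
  obtain x where x: "x \<in> S" "x \<noteq> l"
    using assms by blast
  have "\<exists>p \<in> S. (l, p) \<in> E \<and> p \<noteq> l" if "(l, y) \<in> rtrancl_on S E" "y \<noteq> l" for y
    using that by induct auto
  then show ?thesis
    using that x assms unfolding connected_in_def by blast
qed

text \<open>
  Induction on \<open>U\<close>, deleting a leaf \<open>l\<close> from every member of \<open>F\<close>. If \<open>{l}\<close> is itself a
  member, then \<open>l\<close> lies in all of them. Otherwise two members that share \<open>l\<close> both continue to
  the unique neighbour of \<open>l\<close>, so they still meet when \<open>l\<close> is gone.
\<close>

lemma (in pair_graph) subtrees_Helly:
  assumes acyclic: "\<not> (\<exists>p. cycle p \<and> length p \<ge> 3)"
    and "U \<subseteq> pverts G" "U \<noteq> {}"
    and "\<And>S. S \<in> F \<Longrightarrow> S \<subseteq> U \<and> connected_in (parcs G) S"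
    and "\<And>S S'. \<lbrakk>S \<in> F; S' \<in> F\<rbrakk> \<Longrightarrow> S \<inter> S' \<noteq> {}"
  obtains t where "t \<in> U" "\<And>S. S \<in> F \<Longrightarrow> t \<in> S"
proof -
  have "finite U"
    using assms(2) pair_finite_verts finite_subset by blast
  then have "\<exists>t \<in> U. \<forall>S \<in> F. t \<in> S"
    using assms(2-)
  proof (induct U arbitrary: F rule: finite_psubset_induct)
    case (psubset U)
    obtain l where l: "l \<in> U"
      and leaf: "\<And>p q. \<lbrakk>p \<in> U; q \<in> U; (l, p) \<in> parcs G; (l, q) \<in> parcs G\<rbrakk> \<Longrightarrow> p = q"
      using acyclic_obtain_leaf[OF acyclic psubset.prems(1,2)] by metis
    show ?case
    proof (cases "{l} \<in> F \<or> F = {}")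
      case True
      then show ?thesis using l psubset.prems(4) by blast
    next
      case False
      have conn: "connected_in (parcs G) (S - {l})" if "S \<in> F" for S
      proof (rule connected_in_delete_leaf)
        show "sym (parcs G)" by (auto intro: symI arcs_symmetric)
      qed (use that False psubset.prems(3) leaf in blast)+
      have inter: "(S - {l}) \<inter> (S' - {l}) \<noteq> {}" if SS': "S \<in> F" "S' \<in> F" for S S'
      proof (cases "l \<in> S \<and> l \<in> S'")
        case True
        obtain p where "p \<in> S" "(l, p) \<in> parcs G" "p \<noteq> l"
          using connected_in_obtain_neighbour[of "parcs G" S l] SS' True False psubset.prems(3) by blast
        moreover obtain p' where "p' \<in> S'" "(l, p') \<in> parcs G" "p' \<noteq> l"
          using connected_in_obtain_neighbour[of "parcs G" S' l] SS' True False psubset.prems(3) by blast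
        ultimately show ?thesis
          using leaf[of p p'] SS' psubset.prems(3) by blast
      next
        case False
        then show ?thesis using psubset.prems(4)[OF SS'] by blast
      qed
      have "\<exists>t \<in> U - {l}. \<forall>S \<in> (\<lambda>S. S - {l}) ` F. t \<in> S"
      proof (rule psubset.hyps(2))
        show "U - {l} \<noteq> {}"
          using False conn psubset.prems(3) unfolding connected_in_def by blast
      qed (use l psubset.prems conn inter in blast)+
      then obtain t where "t \<in> U - {l}" "\<And>S. S \<in> F \<Longrightarrow> t \<in> S - {l}"
        by (metis imageI)
      then show ?thesis by (metis DiffD1)
    qed
  qed
  then show ?thesis using that by blast
qed

text \<open>
  The Helly property applies to \<open>X\<close>, \<open>A \<union> Y\<close> and \<open>A' \<union> Y\<close>, which pairwise intersect. A
  common node lies in \<open>X\<close>, and it lies in \<open>Y\<close> or in both \<open>A\<close> and \<open>A'\<close>.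
\<close>

lemma (in pair_graph) crossing_subtrees_intersect:
  assumes acyclic: "\<not> (\<exists>p. cycle p \<and> length p \<ge> 3)"
    and sub: "A \<subseteq> pverts G" "A' \<subseteq> pverts G" "X \<subseteq> pverts G" "Y \<subseteq> pverts G"
    and conn: "connected_in (parcs G) A" "connected_in (parcs G) A'"
      "connected_in (parcs G) X" "connected_in (parcs G) Y"
    and cross: "A \<inter> X \<noteq> {}" "A \<inter> Y \<noteq> {}" "A' \<inter> X \<noteq> {}" "A' \<inter> Y \<noteq> {}"
  shows "A \<inter> A' \<noteq> {} \<or> X \<inter> Y \<noteq> {}"
proof -
  let ?F = "{X, A \<union> Y, A' \<union> Y}"
  have nonempty: "X \<noteq> {}" "Y \<noteq> {}" "pverts G \<noteq> {}"
    using cross sub by auto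
  have "connected_in (parcs G) (A \<union> Y)" "connected_in (parcs G) (A' \<union> Y)"
    using conn cross by (auto intro: connected_in_Un)
  then have subtrees: "S \<subseteq> pverts G \<and> connected_in (parcs G) S" if "S \<in> ?F" for S
    using that sub conn by auto
  have "S \<inter> S' \<noteq> {}" if "S \<in> ?F" "S' \<in> ?F" for S S'
    using that cross nonempty by (auto simp: Int_commute Int_Un_distrib Int_Un_distrib2)
  with subtrees obtain t where "\<And>S. S \<in> ?F \<Longrightarrow> t \<in> S"
    using subtrees_Helly[OF acyclic subset_refl nonempty(3), of ?F] by metis
  then show ?thesis by blast
qed

section \<open>Decompositions of a graph and its complement\<close>

text \<open>
  The bag of \<open>t2\<close> is chosen first, to contain a vertex of every pair of vertices that share no bag
  of \<open>T1\<close>; the remaining vertices then fit into one bag of \<open>T1\<close>.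
\<close>

lemma tree_decompositions_bags_cover:
  assumes T1: "tree_decomposition G T1 B1"
    and T2: "tree_decomposition (graph_complement G) T2 B2"
  obtains t1 t2 where "t1 \<in> pverts T1" "t2 \<in> pverts T2" "pverts G \<subseteq> B1 t1 \<union> B2 t2"
proof -
  define V where "V = pverts G"
  define S1 where "S1 v = {t \<in> pverts T1. v \<in> B1 t}" for v
  define S2 where "S2 v = {t \<in> pverts T2. v \<in> B2 t}" for v
  have trees: "undirected_tree T1" "undirected_tree T2"
    using T1 T2 unfolding tree_decomposition_def by - (elim conjE, assumption)+
  interpret T1: pair_graph T1
    using trees(1) unfolding undirected_tree_def by (rule conjunct1)
  interpret T2: pair_graph T2
    using trees(2) unfolding undirected_tree_def by (rule conjunct1)
  have tree: "\<not> (\<exists>p. T1.cycle p \<and> length p \<ge> 3)" "\<not> (\<exists>p. T2.cycle p \<and> length p \<ge> 3)"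
    using trees unfolding undirected_tree_def by blast+
  have nonempty: "pverts T1 \<noteq> {}" "pverts T2 \<noteq> {}"
    using trees unfolding undirected_tree_def connected_conv with_proj_simps by blast+
  have sub: "S1 v \<subseteq> pverts T1" "S2 v \<subseteq> pverts T2" for v
    by (auto simp: S1_def S2_def)
  have conn: "connected_in (parcs T1) (S1 v)" "connected_in (parcs T2) (S2 v)" if "v \<in> V" for v
  proof -
    have "v \<in> pverts G" "v \<in> pverts (graph_complement G)"
      using that by (simp_all add: V_def graph_complement_def)
    then have "connected (with_proj T1 \<restriction> S1 v)" "connected (with_proj T2 \<restriction> S2 v)"
      using T1 T2 unfolding tree_decomposition_def S1_def S2_def by blast+
    then show "connected_in (parcs T1) (S1 v)" "connected_in (parcs T2) (S2 v)"
      using T1.connected_in_if_connected T2.connected_in_if_connected by blast+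
  qed
  have meet: "S2 u \<inter> S2 v \<noteq> {}" if "u \<in> V" "v \<in> V" "S1 u \<inter> S1 v = {}" for u v
  proof -
    have "u \<noteq> v"
      using that conn(1) by (auto simp: connected_in_def)
    moreover have "(u, v) \<notin> parcs G"
      using that(3) T1 unfolding tree_decomposition_def S1_def by blast
    ultimately have "(u, v) \<in> parcs (graph_complement G)"
      using that by (simp add: graph_complement_def V_def)
    then show ?thesis
      using T2 unfolding tree_decomposition_def S2_def by blast
  qed
  let ?F = "{S2 u \<union> S2 v |u v. u \<in> V \<and> v \<in> V \<and> S1 u \<inter> S1 v = {}}"
  obtain t2 where t2: "t2 \<in> pverts T2" "\<And>S. S \<in> ?F \<Longrightarrow> t2 \<in> S"
  proof (rule T2.subtrees_Helly[OF tree(2) subset_refl nonempty(2), of ?F])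
    fix S assume "S \<in> ?F"
    then show "S \<subseteq> pverts T2 \<and> connected_in (parcs T2) S"
      using sub meet conn by (auto intro!: connected_in_Un)
  next
    fix S S' assume "S \<in> ?F" "S' \<in> ?F"
    then obtain u v x y where *: "u \<in> V" "v \<in> V" "S1 u \<inter> S1 v = {}" "S = S2 u \<union> S2 v"
      "x \<in> V" "y \<in> V" "S1 x \<inter> S1 y = {}" "S' = S2 x \<union> S2 y"
      by blast
    \<comment> \<open>A vertex of one pair and a vertex of the other share no bag of \<open>T1\<close>, hence share one of \<open>T2\<close>.\<close>
    have "\<exists>a \<in> {u, v}. \<exists>b \<in> {x, y}. S1 a \<inter> S1 b = {}"
      using T1.crossing_subtrees_intersect[OF tree(1) sub(1,1,1,1)
          conn(1)[OF *(1)] conn(1)[OF *(2)] conn(1)[OF *(5)] conn(1)[OF *(6)]] *(3,7)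
      by blast
    then obtain a b where "a \<in> {u, v}" "b \<in> {x, y}" "S1 a \<inter> S1 b = {}" by blast
    moreover from this have "S2 a \<inter> S2 b \<noteq> {}"
      using meet *(1,2,5,6) by blast
    ultimately show "S \<inter> S' \<noteq> {}"
      using *(4,8) by blast
  qed blast
  obtain t1 where t1: "t1 \<in> pverts T1" "\<And>S. S \<in> S1 ` (V - B2 t2) \<Longrightarrow> t1 \<in> S"
  proof (rule T1.subtrees_Helly[OF tree(1) subset_refl nonempty(1), of "S1 ` (V - B2 t2)"])
    fix S S' assume "S \<in> S1 ` (V - B2 t2)" "S' \<in> S1 ` (V - B2 t2)"
    then obtain u v where *: "u \<in> V - B2 t2" "v \<in> V - B2 t2" "S = S1 u" "S' = S1 v"
      by blast
    \<comment> \<open>Were these disjoint, \<open>t2\<close> would lie in \<open>S2 u \<union> S2 v\<close>.\<close>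
    then have "t2 \<notin> S2 u \<union> S2 v"
      by (auto simp: S2_def)
    then show "S \<inter> S' \<noteq> {}"
      using t2(2)[of "S2 u \<union> S2 v"] * by blast
  qed (use sub conn in auto)
  have "V \<subseteq> B1 t1 \<union> B2 t2"
    using t1(2) by (auto simp: S1_def)
  then show ?thesis
    using that t1 t2 by (simp add: V_def)
qed

text \<open>
  The decomposition with a single bag ensures that the least width exists.
\<close>

lemma (in pair_wf_digraph) treewidth_attained:
  obtains T :: "nat pair_pre_digraph" and B
  where "tree_decomposition G T B" "decomposition_width T B = treewidth G"
proof -
  let ?T = "\<lparr>pverts = {0}, parcs = {}\<rparr> :: nat pair_pre_digraph"
  interpret T: pair_graph ?T
    by unfold_locales (auto simp: symmetric_def sym_def)
  have "connected (with_proj ?T)" "connected (with_proj ?T \<restriction> {0})"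
    by (auto simp: connected_conv)
  moreover have "\<not> T.cycle p" for p
    by (cases p) (auto simp: T.cycle_def T.awalk_def)
  ultimately have "tree_decomposition G ?T (\<lambda>_. pverts G)"
    using T.pair_graph_axioms
    by (auto simp: tree_decomposition_def undirected_tree_def dest: in_arcsD1 in_arcsD2)
  then have "\<exists>k. \<exists>(T :: nat pair_pre_digraph) B. tree_decomposition G T B \<and> decomposition_width T B = k"
    by blast
  then have "\<exists>(T :: nat pair_pre_digraph) B.
      tree_decomposition G T B \<and> decomposition_width T B = treewidth G"
    unfolding treewidth_def by (rule LeastI_ex)
  then show ?thesis
    using that by blast
qed

lemma card_bag_le:
  assumes "tree_decomposition G T B" "t \<in> pverts T"
  shows "card (B t) \<le> decomposition_width T B + 1"
proof -
  interpret pair_graph T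
    using assms by (simp add: tree_decomposition_def undirected_tree_def)
  have "card (B t) \<le> Max ((\<lambda>t. card (B t)) ` pverts T)"
    using assms(2) pair_finite_verts by simp
  then show ?thesis
    by (simp add: decomposition_width_def)
qed

theorem theorem1:
  fixes G :: "'a pair_pre_digraph" and n :: nat
  assumes "pair_graph G"
    and "pverts G \<noteq> {}"
    and "card (pverts G) = n"
  shows "int (treewidth G) + int (treewidth (graph_complement G)) \<ge> int n - 2"
proof -
  interpret pair_graph G by fact
  interpret complement: pair_wf_digraph "graph_complement G"
    by unfold_locales (auto simp: graph_complement_def)
  obtain T1 :: "nat pair_pre_digraph" and B1
    where T1: "tree_decomposition G T1 B1" "decomposition_width T1 B1 = treewidth G"
    by (rule treewidth_attained)
  obtain T2 :: "nat pair_pre_digraph" and B2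
    where T2: "tree_decomposition (graph_complement G) T2 B2"
      "decomposition_width T2 B2 = treewidth (graph_complement G)"
    by (rule complement.treewidth_attained)
  obtain t1 t2 where t: "t1 \<in> pverts T1" "t2 \<in> pverts T2" "pverts G \<subseteq> B1 t1 \<union> B2 t2"
    using tree_decompositions_bags_cover[OF T1(1) T2(1)] .
  have "B1 t1 \<union> B2 t2 \<subseteq> pverts G"
    using T1(1) T2(1) t(1,2) by (auto simp: tree_decomposition_def graph_complement_def)
  then have "pverts G = B1 t1 \<union> B2 t2"
    using t(3) by blast
  then have "n \<le> card (B1 t1) + card (B2 t2)"
    using assms(3) card_Un_le by metis
  also have "\<dots> \<le> (treewidth G + 1) + (treewidth (graph_complement G) + 1)"
    using card_bag_le[OF T1(1) t(1)] card_bag_le[OF T2(1) t(2)] T1(2) T2(2) by simp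
  finally show ?thesis by simp
qed

end
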